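(* For every integer $K$, every positive integer $e$ and every odd prime $p$, $\omega_K(p^e)=\omega_K(p)$.
   Context: For an integer $K$, the $K$-Fibonacci sequence is $F_{K,0}=0$, $F_{K,1}=1$, $F_{K,n}=KF_{K,n-1}+F_{K,n-2}$ for $n\ge2$. For an integer $m\ge 2$, $\pi_K(m)$ is the least positive period of $(F_{K,n}\bmod m)$ and $\omega_K(m)$ is the number of indices $0\le n<\pi_K(m)$ with $m\mid F_{K,n}$. *)

theory Defs
  imports "HOL-Number_Theory.Number_Theory"
begin

fun kfib :: "int \<Rightarrow> nat \<Rightarrow> int" where
  "kfib K 0 = 0"
| "kfib K (Suc 0) = 1"
| "kfib K (Suc (Suc n)) = K * kfib K (Suc n) + kfib K n"

text \<open>
  The recurrence can be run backwards modulo any m, so for m at least 2 the reduced sequence is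
  purely periodic and the minimum below is taken over a nonempty set.
\<close>
definition kfib_period :: "int \<Rightarrow> int \<Rightarrow> nat" where
  "kfib_period K m =
     (LEAST t. t > 0 \<and> (\<forall>n. kfib K (n + t) mod m = kfib K n mod m))"

definition kfib_zeros :: "int \<Rightarrow> int \<Rightarrow> nat" where
  "kfib_zeros K m = card {n. n < kfib_period K m \<and> m dvd kfib K n}"

end

theory Submission
  imports Defs
begin

text \<open>
  Let \<open>a\<close> be the least positive index with \<open>m dvd kfib K a\<close> and put \<open>x = kfib K (a + 1)\<close>.
  The zeros modulo \<open>m\<close> are the multiples of \<open>a\<close>, and \<open>kfib K (a * d + 1)\<close> is congruent to \<open>x ^ d\<close>,
  so the number of zeros in a period is the multiplicative order of \<open>x\<close>; Cassini's identity gives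
  \<open>x ^ 4 = 1\<close>. If \<open>p ^ e\<close> divides \<open>kfib K n\<close>, then \<open>p ^ (e + 1)\<close> divides \<open>kfib K (p * n)\<close>, so the
  least index for \<open>p ^ e\<close> is that for \<open>p\<close> times a divisor \<open>k\<close> of a power of \<open>p\<close>. As \<open>k\<close> is odd,
  \<open>x\<close> and \<open>x ^ k\<close> have the same order modulo \<open>p\<close>, and a fourth root of unity modulo \<open>p ^ e\<close>
  is \<open>1\<close> as soon as it is \<open>1\<close> modulo \<open>p\<close>.
\<close>

section \<open>Addition formulas, Cassini's identity and values at multiples of an index\<close>

lemma kfib_add:
  "kfib K (m + n + 1) = kfib K (m + 1) * kfib K (n + 1) + kfib K m * kfib K n"
proof (induction n rule: kfib.induct[of _ K, case_names 0 1 step])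
  case (step K n)
  have "kfib K (m + Suc (Suc n) + 1) = K * kfib K (m + Suc n + 1) + kfib K (m + n + 1)" by simp
  also have "\<dots> = K * (kfib K (m + 1) * kfib K (Suc n + 1) + kfib K m * kfib K (Suc n))
      + (kfib K (m + 1) * kfib K (n + 1) + kfib K m * kfib K n)"
    by (simp only: step)
  also have "\<dots> = kfib K (m + 1) * kfib K (Suc (Suc n) + 1) + kfib K m * kfib K (Suc (Suc n))"
    by (simp add: algebra_simps)
  finally show ?case .
qed (simp_all add: algebra_simps)

text \<open>The factor \<open>kfib K (m + 1) - K * kfib K m\<close> stands for the value at index
  \<open>m - 1\<close> and also makes sense at \<open>m = 0\<close>.\<close>

lemma kfib_add':
  "kfib K (m + n) = kfib K m * kfib K (n + 1) + (kfib K (m + 1) - K * kfib K m) * kfib K n"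
proof (cases n)
  case (Suc j)
  then show ?thesis using kfib_add[of K m j] by (simp add: algebra_simps)
qed simp

lemma kfib_cassini:
  "kfib K (n + 1) ^ 2 - K * kfib K (n + 1) * kfib K n - kfib K n ^ 2 = (-1) ^ n"
proof (induction n)
  case (Suc n)
  have "kfib K (Suc n + 1) ^ 2 - K * kfib K (Suc n + 1) * kfib K (Suc n) - kfib K (Suc n) ^ 2
      = - (kfib K (n + 1) ^ 2 - K * kfib K (n + 1) * kfib K n - kfib K n ^ 2)"
    by (simp add: algebra_simps power2_eq_square)
  then show ?case using Suc by simp
qed simp

text \<open>Since \<open>kfib K n\<close> divides \<open>kfib K (n * k)\<close>, the products of the
  two vanish modulo the square and the induction becomes linear. The extra factor
  \<open>kfib K (n + 1)\<close> in the second congruence avoids the exponent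
  \<open>k - 1\<close>.\<close>

lemma kfib_multiple_mod_square:
  "[kfib K (n * k + 1) = kfib K (n + 1) ^ k] (mod (kfib K n)\<^sup>2) \<and>
   [kfib K (n * k) * kfib K (n + 1) = int k * kfib K n * kfib K (n + 1) ^ k] (mod (kfib K n)\<^sup>2) \<and>
   kfib K n dvd kfib K (n * k)"
proof (induction k)
  case (Suc k)
  define a b A B where "a = kfib K n" and "b = kfib K (n + 1)"
    and "A = kfib K (n * k)" and "B = kfib K (n * k + 1)"
  note defs = a_def b_def A_def B_def
  have A': "kfib K (n * Suc k) = A * b + (B - K * A) * a"
    using kfib_add'[of K "n * k" n] by (simp add: defs algebra_simps)
  have B': "kfib K (n * Suc k + 1) = B * b + A * a"
    using kfib_add[of K "n * k" n] by (simp add: defs algebra_simps)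
  have IH: "[B = b ^ k] (mod a\<^sup>2)" "[A * b = int k * a * b ^ k] (mod a\<^sup>2)" "a dvd A"
    using Suc by (simp_all add: defs)
  have Aa: "[A * a = 0] (mod a\<^sup>2)"
    using IH(3) by (simp add: cong_0_iff power2_eq_square)
  have "[B * b + A * a = b ^ k * b + 0] (mod a\<^sup>2)"
    by (intro cong_add cong_mult IH Aa cong_refl)
  moreover have "[(A * b) * b + (B * a * b - K * b * (A * a))
      = (int k * a * b ^ k) * b + (b ^ k * a * b - K * b * 0)] (mod a\<^sup>2)"
    by (intro cong_add cong_diff cong_mult IH Aa cong_refl)
  moreover have "a dvd A * b + (B - K * A) * a" using IH(3) by auto
  ultimately show ?case
    unfolding A' B' unfolding a_def[symmetric] b_def[symmetric]
    by (simp add: algebra_simps)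
qed auto

lemma kfib_dvd_multiple: "m dvd kfib K n \<Longrightarrow> m dvd kfib K (n * k)"
  by (erule dvd_trans) (rule kfib_multiple_mod_square[THEN conjunct2, THEN conjunct2])

lemma kfib_Suc_multiple_cong:
  assumes "m dvd kfib K n"
  shows "[kfib K (n * k + 1) = kfib K (n + 1) ^ k] (mod m)"
proof -
  have "m dvd (kfib K n)\<^sup>2" using assms by (simp add: power2_eq_square)
  then show ?thesis
    by (rule cong_dvd_modulus[OF kfib_multiple_mod_square[THEN conjunct1]])
qed

text \<open>Modulo \<open>m\<close> Cassini's identity shrinks to
  \<open>kfib K (n + 1) ^ 2 = (-1) ^ n\<close>; squaring removes the sign.\<close>

lemma kfib_Suc_fourth_power_cong:
  assumes "m dvd kfib K n"
  shows "[kfib K (n + 1) ^ 4 = 1] (mod m)"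
proof -
  have "[kfib K n = 0] (mod m)" using assms by (simp add: cong_0_iff)
  then have "[kfib K (n + 1) ^ 2 - K * kfib K (n + 1) * kfib K n - kfib K n ^ 2
      = kfib K (n + 1) ^ 2 - K * kfib K (n + 1) * 0 - 0 ^ 2] (mod m)"
    by (intro cong_diff cong_mult cong_pow cong_refl)
  then have "[kfib K (n + 1) ^ 2 = (-1) ^ n] (mod m)"
    unfolding kfib_cassini by (simp add: cong_sym)
  then have "[(kfib K (n + 1) ^ 2) ^ 2 = ((-1) ^ n) ^ 2] (mod m)" by (rule cong_pow)
  then show ?thesis by (simp flip: power_mult)
qed

lemma coprime_kfib_Suc:
  assumes "m dvd kfib K n"
  shows "coprime (kfib K (n + 1)) m"
proof -
  have "coprime (kfib K (n + 1) ^ 4) m"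
    using cong_imp_coprime[OF cong_sym[OF kfib_Suc_fourth_power_cong[OF assms]]] by simp
  then show ?thesis by simp
qed

text \<open>As \<open>e > 0\<close>, the congruence modulo \<open>(kfib K n)\<^sup>2\<close> also
  holds modulo \<open>p ^ Suc e\<close>. The new factor \<open>p\<close> is the multiplier of the
  index, and the unit \<open>kfib K (n + 1)\<close> cancels.\<close>

lemma kfib_prime_power_step:
  assumes "p ^ e dvd kfib K n" "e > 0"
  shows "p ^ Suc e dvd kfib K (n * nat p)"
\<comment> \<open>For negative \<open>p\<close>, \<open>nat p\<close> is \<open>0\<close>, and the
  value at index \<open>0\<close> is \<open>0\<close>.\<close>
proof (cases "p \<ge> 0")
  case True
  have "p ^ Suc e dvd (p ^ e)\<^sup>2"
    using assms(2) by (simp only: power_mult[symmetric]) (rule le_imp_power_dvd, simp)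
  moreover have "(p ^ e)\<^sup>2 dvd (kfib K n)\<^sup>2" using assms by simp
  ultimately have "[kfib K (n * nat p) * kfib K (n + 1)
      = int (nat p) * kfib K n * kfib K (n + 1) ^ nat p] (mod p ^ Suc e)"
    using kfib_multiple_mod_square[of K n "nat p"] by (meson cong_dvd_modulus dvd_trans)
  moreover have "p ^ Suc e dvd int (nat p) * kfib K n * kfib K (n + 1) ^ nat p"
    using assms True by (simp add: mult_dvd_mono)
  ultimately have "p ^ Suc e dvd kfib K (n * nat p) * kfib K (n + 1)"
    using cong_dvd_iff by blast
  moreover have "coprime (p ^ Suc e) (kfib K (n + 1))"
    using coprime_kfib_Suc[OF assms(1)] assms(2) by (simp add: coprime_commute)
  ultimately show ?thesis using coprime_dvd_mult_left_iff by blast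
qed simp

lemma kfib_prime_power:
  assumes "p dvd kfib K n" "p \<ge> 0"
  shows "p ^ Suc j dvd kfib K (n * nat p ^ j)"
proof (induction j)
  case (Suc j)
  then show ?case using kfib_prime_power_step[OF Suc] by (simp add: ac_simps)
qed (use assms in simp)

section \<open>Periods modulo m\<close>

definition kfib_is_period :: "int \<Rightarrow> int \<Rightarrow> nat \<Rightarrow> bool" where
  "kfib_is_period K m t \<longleftrightarrow> (\<forall>n. [kfib K (n + t) = kfib K n] (mod m))"

lemma kfib_is_period_iff:
  "kfib_is_period K m t \<longleftrightarrow> m dvd kfib K t \<and> [kfib K (t + 1) = 1] (mod m)"
proof
  assume "kfib_is_period K m t"
  then have "[kfib K (0 + t) = kfib K 0] (mod m)" "[kfib K (1 + t) = kfib K 1] (mod m)"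
    unfolding kfib_is_period_def by blast+
  then show "m dvd kfib K t \<and> [kfib K (t + 1) = 1] (mod m)" by (simp add: cong_0_iff)
next
  assume "m dvd kfib K t \<and> [kfib K (t + 1) = 1] (mod m)"
  then have t: "[kfib K t = 0] (mod m)" "[kfib K (t + 1) = 1] (mod m)" by (simp_all add: cong_0_iff)
  show "kfib_is_period K m t"
    unfolding kfib_is_period_def
  proof
    fix n
    have "[kfib K n * kfib K (t + 1) + (kfib K (n + 1) - K * kfib K n) * kfib K t
        = kfib K n * 1 + (kfib K (n + 1) - K * kfib K n) * 0] (mod m)"
      by (intro cong_add cong_mult t cong_refl)
    then show "[kfib K (n + t) = kfib K n] (mod m)" by (simp add: kfib_add')
  qed
qed

text \<open>Running the recurrence backwards moves the agreement of two consecutive values from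
  \<open>i\<close> down to \<open>0\<close>.\<close>

lemma kfib_is_period_diff:
  assumes "[kfib K (i + t) = kfib K i] (mod m)" "[kfib K (i + t + 1) = kfib K (i + 1)] (mod m)"
  shows "kfib_is_period K m t"
  using assms
proof (induction i)
  case 0
  then show ?case by (simp add: kfib_is_period_iff cong_0_iff)
next
  case (Suc i)
  have "[kfib K (Suc i + t + 1) - K * kfib K (Suc i + t)
       = kfib K (Suc i + 1) - K * kfib K (Suc i)] (mod m)"
    by (intro cong_diff cong_mult Suc.prems cong_refl)
  then have "[kfib K (i + t) = kfib K i] (mod m)" by simp
  then show ?case using Suc by simp
qed

lemma kfib_period_exists:
  assumes "m > 0"
  shows "\<exists>t>0. kfib_is_period K m t"
proof -
  \<comment> \<open>Pigeonhole: there are only finitely many pairs of consecutive residues.\<close>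
  define g where "g i = (kfib K i mod m, kfib K (i + 1) mod m)" for i
  have "range g \<subseteq> {0..<m} \<times> {0..<m}" using assms by (auto simp: g_def)
  then have "finite (range g)" by (rule finite_subset) simp
  then have "\<not> inj g" using finite_imageD infinite_UNIV_nat by blast
  then obtain i j where "i < j" "g i = g j"
    by (metis injI linorder_neqE_nat)
  moreover from this obtain t where "j = i + t" "t > 0" using less_imp_add_positive by blast
  ultimately show ?thesis
    using kfib_is_period_diff[of K i t m] by (auto simp: g_def cong_def)
qed

section \<open>The rank of apparition and the number of zeros in a period\<close>

definition kfib_rank :: "int \<Rightarrow> int \<Rightarrow> nat" where
  "kfib_rank K m = (LEAST n. n > 0 \<and> m dvd kfib K n)"

lemma kfib_rank:
  assumes "m > 0"
  shows "kfib_rank K m > 0" "m dvd kfib K (kfib_rank K m)"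
proof -
  obtain n where "n > 0 \<and> m dvd kfib K n"
    using kfib_period_exists[OF assms] kfib_is_period_iff by blast
  then have "kfib_rank K m > 0 \<and> m dvd kfib K (kfib_rank K m)"
    unfolding kfib_rank_def by (rule LeastI)
  then show "kfib_rank K m > 0" "m dvd kfib K (kfib_rank K m)" by auto
qed

text \<open>Divide \<open>n\<close> by the rank with remainder \<open>r\<close>. The addition
  formula and the unit \<open>kfib K (q + 1)\<close> make \<open>r\<close> an index of a zero, so
  \<open>r = 0\<close> by minimality.\<close>

lemma dvd_kfib_iff:
  assumes "m > 0"
  shows "m dvd kfib K n \<longleftrightarrow> kfib_rank K m dvd n"
proof
  assume n: "m dvd kfib K n"
  define a where "a = kfib_rank K m"
  define q r where "q = a * (n div a)" and "r = n mod a"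
  have a: "a > 0" "m dvd kfib K a" using kfib_rank[OF assms] by (simp_all add: a_def)
  have q: "m dvd kfib K q" unfolding q_def by (rule kfib_dvd_multiple[OF a(2)])
  have "m dvd kfib K r * kfib K (q + 1) + (kfib K (r + 1) - K * kfib K r) * kfib K q"
    using n kfib_add'[of K r q] by (simp add: q_def r_def)
  then have "m dvd kfib K r * kfib K (q + 1)" using q by (simp add: dvd_add_left_iff)
  then have "m dvd kfib K r"
    using coprime_kfib_Suc[OF q] by (simp add: coprime_commute coprime_dvd_mult_left_iff)
  moreover have "r < a" using a by (simp add: r_def)
  ultimately have "r = 0"
    using not_less_Least[of r "\<lambda>n. n > 0 \<and> m dvd kfib K n"]
    by (simp add: a_def kfib_rank_def)
  then show "kfib_rank K m dvd n" by (auto simp: r_def a_def)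
next
  assume "kfib_rank K m dvd n"
  then show "m dvd kfib K n"
    using kfib_dvd_multiple[OF kfib_rank(2)[OF assms, of K]] by auto
qed

text \<open>The right side is the multiplicative order \<open>d\<close> of
  \<open>kfib K (a + 1)\<close>, where \<open>a\<close> is the rank. The least period is
  \<open>a * d\<close>, and the zeros below it are \<open>a * i\<close> with
  \<open>i < d\<close>.\<close>

lemma kfib_zeros_eq:
  assumes "m > 0"
  shows "kfib_zeros K m = (LEAST d. d > 0 \<and> [kfib K (kfib_rank K m + 1) ^ d = 1] (mod m))"
    (is "_ = (LEAST d. ?Q d)")
proof -
  define a where "a = kfib_rank K m"
  have a: "a > 0" "m dvd kfib K a" using kfib_rank[OF assms] by (simp_all add: a_def)
  have period_iff: "a * d > 0 \<and> kfib_is_period K m (a * d) \<longleftrightarrow> ?Q d" for d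
    using a kfib_dvd_multiple[OF a(2), of d] kfib_Suc_multiple_cong[OF a(2), of d]
    unfolding kfib_is_period_iff a_def[symmetric] by (auto intro: cong_trans cong_sym)
  define d where "d = (LEAST d. ?Q d)"
  have "?Q 4" using kfib_Suc_fourth_power_cong[OF a(2)] by (simp add: a_def)
  then have d: "?Q d" unfolding d_def by (rule LeastI)
  have "kfib_period K m = (LEAST t. t > 0 \<and> kfib_is_period K m t)"
    by (simp add: kfib_period_def kfib_is_period_def cong_def)
  also have "\<dots> = a * d"
  proof (rule Least_equality)
    show "a * d > 0 \<and> kfib_is_period K m (a * d)" using d period_iff by blast
    fix t assume t: "t > 0 \<and> kfib_is_period K m t"
    then obtain c where c: "t = a * c"
      using dvd_kfib_iff[OF assms, of K t] unfolding kfib_is_period_iff a_def[symmetric] by blast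
    then have "?Q c" using t period_iff by blast
    then show "a * d \<le> t" unfolding c d_def by (simp add: Least_le)
  qed
  finally have "{n. n < kfib_period K m \<and> m dvd kfib K n} = (\<lambda>i. a * i) ` {..<d}"
    using a(1) by (auto simp: dvd_kfib_iff[OF assms] a_def[symmetric])
  moreover have "inj_on (\<lambda>i. a * i) {..<d}" using a(1) by (auto simp: inj_on_def)
  ultimately show ?thesis
    unfolding d_def[symmetric] by (simp add: kfib_zeros_def card_image)
qed

section \<open>Passing from p to its powers\<close>

lemma fourth_root_of_unity_cong_1:
  fixes y p :: int
  assumes "prime p" "odd p" "[y ^ 4 = 1] (mod p ^ e)" "[y = 1] (mod p)"
  shows "[y = 1] (mod p ^ e)"
proof -
  \<comment> \<open>Modulo \<open>p\<close> both \<open>y + 1\<close> and \<open>y ^ 2 + 1\<close>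
    are \<open>2\<close>, a unit as \<open>p\<close> is odd. So in the factorization of
    \<open>y ^ 4 - 1\<close> all of \<open>p ^ e\<close> falls on \<open>y - 1\<close>.\<close>
  have "\<not> p dvd 2" using assms(1,2) using primes_dvd_imp_eq[of p 2] by auto
  moreover have "[y + 1 = 1 + 1] (mod p)" "[y ^ 2 + 1 = 1 ^ 2 + 1] (mod p)"
    by (intro cong_add cong_pow assms(4) cong_refl)+
  ultimately have "\<not> p dvd y + 1" "\<not> p dvd y ^ 2 + 1"
    using cong_dvd_iff[of "y + 1" 2 p] cong_dvd_iff[of "y ^ 2 + 1" 2 p] by simp_all
  then have "coprime (p ^ e) ((y + 1) * (y ^ 2 + 1))"
    using assms(1) by (simp add: prime_imp_coprime)
  moreover have "p ^ e dvd (y - 1) * ((y + 1) * (y ^ 2 + 1))"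
  proof -
    have "(y - 1) * ((y + 1) * (y ^ 2 + 1)) = y ^ 4 - 1"
      by (simp add: algebra_simps power2_eq_square power4_eq_xxxx)
    then show ?thesis using assms(3) by (simp add: cong_iff_dvd_diff)
  qed
  ultimately show ?thesis by (simp add: coprime_dvd_mult_left_iff cong_iff_dvd_diff)
qed

theorem theorem4p21:
  fixes K p :: int and e :: nat
  assumes "e > 0" and "prime p" and "odd p"
  shows "kfib_zeros K (p ^ e) = kfib_zeros K p"
proof -
  have p: "p > 0" using assms(2) by (rule prime_gt_0_int)
  then have pe: "p ^ e > 0" by simp
  have p_dvd: "p dvd p ^ e" using assms(1) by simp
  define a b where "a = kfib_rank K p" and "b = kfib_rank K (p ^ e)"
  define x y where "x = kfib K (a + 1)" and "y = kfib K (b + 1)"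
  have a: "a > 0" "p dvd kfib K a" using kfib_rank[OF p] by (simp_all add: a_def)
  have b: "p ^ e dvd kfib K b" using kfib_rank[OF pe] by (simp add: b_def)
  obtain k where k: "b = a * k"
    using dvd_kfib_iff[OF p, of K b] dvd_trans[OF p_dvd b] by (auto simp: a_def)
  have "p ^ e dvd kfib K (a * nat p ^ (e - 1))"
    using kfib_prime_power[of p K a "e - 1"] a p assms(1) by simp
  then have "b dvd a * nat p ^ (e - 1)"
    using dvd_kfib_iff[OF pe] by (simp add: b_def)
  then have "k dvd nat p ^ (e - 1)" using k a(1) by simp
  moreover have "odd (nat p ^ (e - 1))" using assms(3) p by (simp add: even_nat_iff)
  ultimately have "odd k" using dvd_trans by blast
  then obtain i where "k = 2 * i + 1" by (rule oddE)
  \<comment> \<open>An odd square is 1 modulo 4, so on fourth roots of unity raising to the power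
    \<open>k\<close> is its own inverse. This recovers \<open>x\<close> from \<open>y\<close> modulo
    \<open>p\<close>.\<close>
  then have "k * k = 4 * (i * i + i) + 1" by (simp add: algebra_simps)
  then obtain j where j: "k * k = 4 * j + 1" by blast
  have x4: "[x ^ 4 = 1] (mod p)" and y4: "[y ^ 4 = 1] (mod p ^ e)"
    unfolding x_def y_def by (intro kfib_Suc_fourth_power_cong a(2) b)+
  have yx: "[y = x ^ k] (mod p)"
    unfolding x_def y_def k by (rule kfib_Suc_multiple_cong[OF a(2)])
  have "[(x ^ 4) ^ j * x = 1 ^ j * x] (mod p)"
    by (intro cong_mult cong_pow x4 cong_refl)
  then have "[(x ^ k) ^ k = x] (mod p)" by (simp add: j mult.commute flip: power_mult)
  then have xy: "[x = y ^ k] (mod p)"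
    using cong_pow[OF yx, of k] by (metis cong_sym cong_trans)
  \<comment> \<open>Both orders are least elements of sets of exponents, so it suffices that these
    sets coincide.\<close>
  have "[y ^ d = 1] (mod p ^ e) \<longleftrightarrow> [x ^ d = 1] (mod p)" for d
  proof
    assume "[y ^ d = 1] (mod p ^ e)"
    then have "[y ^ d = 1] (mod p)" using p_dvd by (rule cong_dvd_modulus)
    then have "[(y ^ d) ^ k = 1 ^ k] (mod p)" by (rule cong_pow)
    moreover have "[x ^ d = (y ^ k) ^ d] (mod p)" by (rule cong_pow[OF xy])
    ultimately show "[x ^ d = 1] (mod p)"
      by (metis cong_trans power_mult mult.commute power_one)
  next
    assume "[x ^ d = 1] (mod p)"
    then have "[(x ^ d) ^ k = 1 ^ k] (mod p)" by (rule cong_pow)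
    moreover have "[y ^ d = (x ^ k) ^ d] (mod p)" by (rule cong_pow[OF yx])
    ultimately have "[y ^ d = 1] (mod p)"
      by (metis cong_trans power_mult mult.commute power_one)
    moreover have "[(y ^ d) ^ 4 = 1] (mod p ^ e)"
      using cong_pow[OF y4, of d] by (metis power_mult mult.commute power_one)
    ultimately show "[y ^ d = 1] (mod p ^ e)"
      using fourth_root_of_unity_cong_1 assms by blast
  qed
  then show ?thesis
    unfolding kfib_zeros_eq[OF p] kfib_zeros_eq[OF pe] a_def[symmetric] b_def[symmetric]
      x_def[symmetric] y_def[symmetric] by simp
qed

end
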